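(* Let $n\ge 1$, let $H\in\mathbb{R}^{n\times n}$ be symmetric and not a scalar matrix (i.e. not of the form $tI$ with $t\in\mathbb{R}$), let $c\in\mathbb{R}^n$, and let $\tau=\mathrm{tr}(H)/n$. Then the problem $$\min\left\{\tfrac12x^THx+c^Tx:\ x\in\mathbb{R}^n,\ x^Tx=1\right\}$$ has the same global minimizers as the problem $$\min\left\{\tfrac12x^T(H-\tau I)x+c^Tx:\ x\in\mathbb{R}^n,\ x^Tx\le1\right\}.$$
   Context: $\mathrm{tr}$ denotes the trace and $I$ the $n\times n$ identity matrix. *)

theory Defs
  imports "HOL-Analysis.Analysis"
begin

definition quad_obj :: "real ^ 'n ^ 'n \<Rightarrow> real ^ 'n \<Rightarrow> real ^ 'n \<Rightarrow> real" where
  "quad_obj A c x = (1 / 2) * (x \<bullet> (A *v x)) + c \<bullet> x"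

definition global_minimizers :: "('a \<Rightarrow> real) \<Rightarrow> 'a set \<Rightarrow> 'a set" where
  "global_minimizers f S = {x. is_arg_min f (\<lambda>y. y \<in> S) x}"

end

theory Submission
  imports Defs
begin

text \<open>Put \<open>A = H - \<tau> I\<close>. On the unit sphere the two objectives differ by the constant \<open>\<tau> / 2\<close>, so it
  suffices that every minimizer over the ball lies on the sphere. Since \<open>A\<close> is symmetric, nonzero and
  traceless, it has a direction \<open>v\<close> of negative curvature; moving from an interior point a short way
  along \<open>v\<close> or \<open>-v\<close>, whichever does not increase the first-order term, strictly decreases the
  objective.\<close>

text \<open>If the quadratic form were nonnegative, the diagonal entries would be nonnegative with
  sum zero, hence all zero. Testing the form on sums and differences of basis vectors then kills the
  off-diagonal entries too.\<close>

lemma traceless_symmetric_negative_direction: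
  fixes A :: "real ^ 'n ^ 'n"
  assumes sym: "transpose A = A" and tr: "trace A = 0" and nz: "A \<noteq> 0"
  shows "\<exists>v. v \<bullet> (A *v v) < 0"
proof (rule ccontr)
  assume "\<not> ?thesis"
  then have psd: "0 \<le> v \<bullet> (A *v v)" for v
    by (simp add: not_less)
  have entry: "axis i 1 \<bullet> (A *v axis j 1) = A $ i $ j" for i j
    by (simp add: inner_axis' matrix_vector_mult_basis column_def)
  have "0 \<le> A $ i $ i" for i
    using psd[of "axis i 1"] by (simp add: entry)
  then have diag: "A $ i $ i = 0" for i
    using tr by (simp add: trace_def sum_nonneg_eq_0_iff)
  have "A $ i $ j = 0" for i j
  proof -
    have "A $ i $ j = A $ j $ i"
      using sym by (metis transpose_def vec_lambda_beta)
    \<comment> \<open>With zero diagonal and symmetry, the form takes the values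
      \<open>2 * A $ i $ j\<close> and \<open>- 2 * A $ i $ j\<close> at these two vectors.\<close>
    then have "0 \<le> A $ i $ j" "A $ i $ j \<le> 0"
      using psd[of "axis i 1 + axis j 1"] psd[of "axis i 1 - axis j 1"]
      by (simp_all add: matrix_vector_right_distrib matrix_vector_mult_diff_distrib
          inner_add_left inner_add_right inner_diff_left inner_diff_right entry diag)
    then show ?thesis by simp
  qed
  then have "A = 0"
    by (simp add: vec_eq_iff)
  with nz show False ..
qed

text \<open>The exact Taylor expansion along a line; both cross terms appear because
  \<open>A\<close> is arbitrary here.\<close>

lemma quad_obj_add_scaleR:
  "quad_obj A c (x + t *\<^sub>R v)
    = quad_obj A c x + t * ((x \<bullet> (A *v v) + v \<bullet> (A *v x)) / 2 + c \<bullet> v) + t\<^sup>2 * (v \<bullet> (A *v v)) / 2"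
  by (simp add: quad_obj_def matrix_vector_right_distrib matrix_vector_mult_scaleR inner_add_left
      inner_add_right field_simps power2_eq_square)

lemma quad_obj_diff_scalar_mat:
  "quad_obj (A - t *\<^sub>R mat 1) c x = quad_obj A c x - t * (x \<bullet> x) / 2"
  by (simp add: quad_obj_def matrix_vector_mult_diff_rdistrib scaleR_matrix_vector_assoc[symmetric]
      inner_diff_right field_simps)

lemma continuous_on_quad_obj: "continuous_on S (quad_obj A c)"
  unfolding quad_obj_def
  by (intro continuous_intros linear_continuous_on matrix_vector_mul_bounded_linear)

lemma negative_direction_decreases_quad_obj:
  fixes A :: "real ^ 'n ^ 'n"
  assumes neg: "v \<bullet> (A *v v) < 0" and "open U" and "x \<in> U"
  shows "\<exists>y\<in>U. quad_obj A c y < quad_obj A c x"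
proof -
  from assms obtain e where e: "e > 0" "ball x e \<subseteq> U"
    by (meson openE)
  have "v \<noteq> 0"
    using neg by auto
  define L where "L = (x \<bullet> (A *v v) + v \<bullet> (A *v x)) / 2 + c \<bullet> v"
  \<comment> \<open>A step of this size moves \<open>x\<close> by distance \<open>e / 2\<close>,
    which keeps it in the ball. No further smallness is required: once \<open>t * L \<le> 0\<close>,
    the quadratic term alone forces a strict decrease.\<close>
  define r where "r = e / (2 * norm v)"
  define t where "t = (if L \<le> 0 then r else - r)"
  have "r > 0"
    using e \<open>v \<noteq> 0\<close> by (simp add: r_def)
  then have abs_t: "\<bar>t\<bar> = r" and "t * L \<le> 0"
    by (auto simp: t_def mult_le_0_iff)
  have "t\<^sup>2 * (v \<bullet> (A *v v)) < 0"
    using \<open>r > 0\<close> abs_t neg by (auto simp: mult_less_0_iff)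
  with \<open>t * L \<le> 0\<close> have "quad_obj A c (x + t *\<^sub>R v) < quad_obj A c x"
    by (simp add: quad_obj_add_scaleR L_def)
  moreover have "x + t *\<^sub>R v \<in> ball x e"
    using e \<open>v \<noteq> 0\<close> by (simp add: dist_norm abs_t r_def)
  ultimately show ?thesis
    using e by blast
qed

lemma global_minimizers_cong_add_const:
  assumes "\<And>x. x \<in> S \<Longrightarrow> f x = g x + (k::real)"
  shows "global_minimizers f S = global_minimizers g S"
  using assms by (auto simp: global_minimizers_def is_arg_min_def)

text \<open>Some minimizer over \<open>S\<close> lies in \<open>T\<close>, so both minimum values
  agree. Nonemptiness matters: \<open>f\<close> may attain a minimum on \<open>T\<close> but none on
  \<open>S\<close>.\<close>

lemma global_minimizers_subset_eq:
  fixes f :: "'a \<Rightarrow> real"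
  assumes "T \<subseteq> S" and "global_minimizers f S \<subseteq> T" and "global_minimizers f S \<noteq> {}"
  shows "global_minimizers f T = global_minimizers f S"
proof -
  obtain z where z: "z \<in> T" "\<And>y. y \<in> S \<Longrightarrow> f z \<le> f y"
    using assms(2,3) by (force simp: global_minimizers_def is_arg_min_def not_less)
  then show ?thesis
    using assms(1,2)
    by (fastforce simp: global_minimizers_def is_arg_min_def not_less)
qed

theorem theorem4p6:
  fixes H :: "real ^ 'n ^ 'n" and c :: "real ^ 'n" and \<tau> :: real
  assumes "transpose H = H"
    and "\<nexists>t :: real. H = t *\<^sub>R mat 1"
    and "\<tau> = trace H / real CARD('n)"
  shows "global_minimizers (quad_obj H c) {x. x \<bullet> x = 1}
       = global_minimizers (quad_obj (H - \<tau> *\<^sub>R mat 1) c) {x. x \<bullet> x \<le> 1}"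
proof -
  define A where "A = H - \<tau> *\<^sub>R mat 1"
  have "transpose A = A"
    using assms(1) by (simp add: A_def vec_eq_iff transpose_def mat_def) 
  \<comment> \<open>The identity has trace \<open>CARD('n)\<close>, so \<open>\<tau>\<close> is
    exactly the shift that cancels the trace.\<close>
  moreover have "trace A = 0"
    using assms(3) by (simp add: A_def trace_def mat_def sum_subtractf)
  moreover have "A \<noteq> 0"
    using assms(2) by (auto simp: A_def)
  ultimately obtain v where v: "v \<bullet> (A *v v) < 0"
    using traceless_symmetric_negative_direction by blast
  have cball: "{x :: real ^ 'n. x \<bullet> x \<le> 1} = cball 0 1"
    by (auto simp: norm_le_square)
  \<comment> \<open>Weierstrass on the compact ball.\<close>
  have "\<exists>z\<in>cball 0 1. \<forall>y\<in>cball 0 1. quad_obj A c z \<le> quad_obj A c y"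
    by (intro continuous_attains_inf continuous_on_quad_obj) auto
  then have nonempty: "global_minimizers (quad_obj A c) {x. x \<bullet> x \<le> 1} \<noteq> {}"
    unfolding cball by (force simp: global_minimizers_def is_arg_min_def not_less)
  have sphere: "global_minimizers (quad_obj A c) {x. x \<bullet> x \<le> 1} \<subseteq> {x. x \<bullet> x = 1}"
  proof
    fix x assume x: "x \<in> global_minimizers (quad_obj A c) {x. x \<bullet> x \<le> 1}"
    \<comment> \<open>The better point supplied for an interior \<open>x\<close> lies in the open
      ball, hence is feasible and contradicts minimality.\<close>
    have "x \<notin> ball 0 1"
      using negative_direction_decreases_quad_obj[OF v open_ball, of x 0 1 c] x
      unfolding cball by (auto simp: global_minimizers_def is_arg_min_def)
    with x have "norm x = 1"
      unfolding cball by (auto simp: global_minimizers_def is_arg_min_def)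
    then show "x \<in> {x. x \<bullet> x = 1}"
      by (simp add: dot_square_norm)
  qed
  have "global_minimizers (quad_obj H c) {x. x \<bullet> x = 1}
      = global_minimizers (quad_obj A c) {x. x \<bullet> x = 1}"
    by (rule global_minimizers_cong_add_const[where k = "\<tau> / 2"])
      (simp add: A_def quad_obj_diff_scalar_mat)
  also have "\<dots> = global_minimizers (quad_obj A c) {x. x \<bullet> x \<le> 1}"
    by (rule global_minimizers_subset_eq[OF _ sphere nonempty]) auto
  finally show ?thesis
    by (simp add: A_def)
qed

end
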